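(* Let ${}^*\mathbb R$ be any hyperreal field whose universe is a set. Then there exist an infinite set $I$, a non-principal ultrafilter $\mathcal U$ on $I$, and a filter $\mathcal G$ on $I\times I$ such that ${}^*\mathbb R$ is isomorphic, as an ordered field, to the quotient $$\bigl(\mathcal A(\mathbb Z\times I,\mathbb Z)|\mathcal G\bigr)/\!\sim_{\sigma\tau}$$ of the set of $\mathbb Z$-valued functions $\mathcal A(\mathbb Z\times I,\mathbb Z)|\mathcal G$.
   Context: Hyperreal field: Let $\mathcal L'=\{+,\cdot,\leqslant,0,1\}\cup\{P_R\}$, with one $m$-ary relation symbol $P_R$ for each $m\ge 1$ and each $R\subseteq\mathbb R^m$; $\mathbb R$ is an $\mathcal L'$-structure with $P_R$ interpreted as $R$. An ordered field is a hyperreal field if it is a proper complete elementary extension of $\mathbb R$, i.e. it properly extends $\mathbb R$ and can be expanded to an $\mathcal L'$-structure that is an $\mathcal L'$-elementary extension of $\mathbb R$. A function $f:\mathbb Z\to\mathbb Z$ is an almost homomorphism if $(p,q)\mapsto f(p+q)-f(p)-f(q)$ has bounded range. For almost homomorphisms $f,g$ write $f\sim_\sigma g$ iff $f-g$ has bounded range, and $[f]_\sigma$ for the class of $f$. The set of classes $[f]_\sigma$ is a complete ordered field isomorphic to $\mathbb R$ (Eudoxus reals): addition is induced by pointwise addition, multiplication by composition, and $[f]_\sigma>0$ iff $\sup_{m\in\mathbb N}f(m)=+\infty$. For a set $I$, $\mathcal A(\mathbb Z\times I,\mathbb Z)$ is the set of all $F:\mathbb Z\times I\to\mathbb Z$ such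 that $F(\cdot,i)$ is an almost homomorphism for every $i\in I$. For $F\in\mathcal A(\mathbb Z\times I,\mathbb Z)$ let $eq(F)=\{(i,j)\in I\times I:[F(\cdot,i)]_\sigma=[F(\cdot,j)]_\sigma\}$. For a filter $\mathcal G$ on $I\times I$, $\mathcal A(\mathbb Z\times I,\mathbb Z)|\mathcal G=\{F\in\mathcal A(\mathbb Z\times I,\mathbb Z): eq(F)\in\mathcal G\}$. For an ultrafilter $\mathcal U$ on $I$, $F\sim_{\sigma\tau}G$ iff $\{i\in I:F(\cdot,i)\sim_\sigma G(\cdot,i)\}\in\mathcal U$. Operations on the quotient by $\sim_{\sigma\tau}$ are induced, for each fixed $i$, by pointwise addition and by composition in the $\mathbb Z$-variable; the class of $F$ is less than the class of $G$ iff $\{i\in I:[F(\cdot,i)]_\sigma<[G(\cdot,i)]_\sigma\}\in\mathcal U$. *)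

theory Defs
  imports Complex_Main "HOL-Library.FuncSet"
begin

section \<open>Hyperreal fields\<close>

datatype trm = Var nat | Zero | One | Plus trm trm | Times trm trm

text \<open>\<open>Rel m R ts\<close> is the relation symbol \<open>P\<^sub>R\<close>, for \<open>R\<close> a set of real \<open>m\<close>-tuples (lists of
  length \<open>m\<close>), applied to the terms \<open>ts\<close>. The arity \<open>m\<close> is part of the symbol because the
  empty relation has every arity. Variables are named; \<open>Ex x\<close> binds \<open>x\<close>.\<close>

datatype fm =
    Eq trm trm
  | Le trm trm
  | Rel nat "real list set" "trm list"
  | Neg fm
  | Conj fm fm
  | Ex nat fm

primrec wf_fm :: "fm \<Rightarrow> bool" where
  "wf_fm (Eq s t) \<longleftrightarrow> True"
| "wf_fm (Le s t) \<longleftrightarrow> True"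
| "wf_fm (Rel m R ts) \<longleftrightarrow> 1 \<le> m \<and> R \<subseteq> {xs. length xs = m} \<and> length ts = m"
| "wf_fm (Neg \<phi>) \<longleftrightarrow> wf_fm \<phi>"
| "wf_fm (Conj \<phi> \<psi>) \<longleftrightarrow> wf_fm \<phi> \<and> wf_fm \<psi>"
| "wf_fm (Ex x \<phi>) \<longleftrightarrow> wf_fm \<phi>"

primrec trm_val :: "(nat \<Rightarrow> 'a::linordered_field) \<Rightarrow> trm \<Rightarrow> 'a" where
  "trm_val v (Var x) = v x"
| "trm_val v Zero = 0"
| "trm_val v One = 1"
| "trm_val v (Plus s t) = trm_val v s + trm_val v t"
| "trm_val v (Times s t) = trm_val v s * trm_val v t"

text \<open>\<open>P m R\<close> is the interpretation of the relation symbol \<open>P\<^sub>R\<close> in the structure; on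
  well-formed formulas only its tuples of length \<open>m\<close> matter.\<close>

primrec sat ::
  "(nat \<Rightarrow> real list set \<Rightarrow> 'a list set) \<Rightarrow> (nat \<Rightarrow> 'a::linordered_field) \<Rightarrow> fm \<Rightarrow> bool"
where
  "sat P v (Eq s t) \<longleftrightarrow> trm_val v s = trm_val v t"
| "sat P v (Le s t) \<longleftrightarrow> trm_val v s \<le> trm_val v t"
| "sat P v (Rel m R ts) \<longleftrightarrow> map (trm_val v) ts \<in> P m R"
| "sat P v (Neg \<phi>) \<longleftrightarrow> \<not> sat P v \<phi>"
| "sat P v (Conj \<phi> \<psi>) \<longleftrightarrow> sat P v \<phi> \<and> sat P v \<psi>"
| "sat P v (Ex x \<phi>) \<longleftrightarrow> (\<exists>a. sat P (v(x := a)) \<phi>)"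

text \<open>The inclusion of the reals into the extension is an embedding \<open>e\<close>. Elementarity, applied
  to atomic formulas, makes \<open>e\<close> an embedding of ordered fields; \<open>\<not> surj e\<close> says that the
  extension is proper.\<close>

definition hyperreal_field :: "'k::linordered_field itself \<Rightarrow> bool" where
  "hyperreal_field (_ :: 'k itself) \<longleftrightarrow>
     (\<exists>(e :: real \<Rightarrow> 'k) (P :: nat \<Rightarrow> real list set \<Rightarrow> 'k list set).
        \<not> surj e \<and>
        (\<forall>\<phi> v. wf_fm \<phi> \<longrightarrow> (sat (\<lambda>m R. R) v \<phi> \<longleftrightarrow> sat P (e \<circ> v) \<phi>)))"


section \<open>Eudoxus reals\<close>

definition almost_hom :: "(int \<Rightarrow> int) \<Rightarrow> bool" where
  "almost_hom f \<longleftrightarrow> (\<exists>C. \<forall>p q. \<bar>f (p + q) - f p - f q\<bar> \<le> C)"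

definition sigma_rel :: "((int \<Rightarrow> int) \<times> (int \<Rightarrow> int)) set" where
  "sigma_rel = {(f, g). almost_hom f \<and> almost_hom g \<and> (\<exists>C. \<forall>p. \<bar>f p - g p\<bar> \<le> C)}"

definition sigma_class :: "(int \<Rightarrow> int) \<Rightarrow> (int \<Rightarrow> int) set" where
  "sigma_class f = sigma_rel `` {f}"

text \<open>\<open>[f] < [g]\<close> means \<open>[g - f] > 0\<close>, that is, \<open>sup (g m - f m) = \<infinity>\<close> over natural \<open>m\<close>;
  this does not depend on the representatives.\<close>

definition sigma_less :: "(int \<Rightarrow> int) set \<Rightarrow> (int \<Rightarrow> int) set \<Rightarrow> bool" where
  "sigma_less X Y \<longleftrightarrow>
     (\<exists>f\<in>X. \<exists>g\<in>Y. \<not> bdd_above (range (\<lambda>m::nat. g (int m) - f (int m))))"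


section \<open>Filters on a set\<close>

text \<open>A filter on a set \<open>A\<close> is a library filter that contains \<open>A\<close>; it is determined by its
  members that are subsets of \<open>A\<close>. Filters are proper.\<close>

definition filter_on :: "'a set \<Rightarrow> 'a filter \<Rightarrow> bool" where
  "filter_on A F \<longleftrightarrow> F \<noteq> bot \<and> F \<le> principal A"

definition ultrafilter_on :: "'a set \<Rightarrow> 'a filter \<Rightarrow> bool" where
  "ultrafilter_on A U \<longleftrightarrow> filter_on A U \<and>
     (\<forall>B\<subseteq>A. eventually (\<lambda>x. x \<in> B) U \<or> eventually (\<lambda>x. x \<in> A - B) U)"

definition nonprincipal_on :: "'a set \<Rightarrow> 'a filter \<Rightarrow> bool" where
  "nonprincipal_on A U \<longleftrightarrow> (\<forall>a\<in>A. \<not> eventually (\<lambda>x. x \<in> {a}) U)"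


section \<open>The quotient of integer-valued functions\<close>

abbreviation slice :: "(int \<times> 'i \<Rightarrow> int) \<Rightarrow> 'i \<Rightarrow> int \<Rightarrow> int" where
  "slice F i \<equiv> (\<lambda>m. F (m, i))"

definition ah_fun :: "'i set \<Rightarrow> (int \<times> 'i \<Rightarrow> int) set" where
  "ah_fun I = {F \<in> UNIV \<times> I \<rightarrow>\<^sub>E UNIV. \<forall>i\<in>I. almost_hom (slice F i)}"

definition eq_set :: "'i set \<Rightarrow> (int \<times> 'i \<Rightarrow> int) \<Rightarrow> ('i \<times> 'i) set" where
  "eq_set I F = {(i, j) \<in> I \<times> I. sigma_class (slice F i) = sigma_class (slice F j)}"

definition ah_fun_limit :: "'i set \<Rightarrow> ('i \<times> 'i) filter \<Rightarrow> (int \<times> 'i \<Rightarrow> int) set" where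
  "ah_fun_limit I \<G> = {F \<in> ah_fun I. eventually (\<lambda>p. p \<in> eq_set I F) \<G>}"

definition sigma_tau_rel ::
  "'i set \<Rightarrow> 'i filter \<Rightarrow> ('i \<times> 'i) filter \<Rightarrow> ((int \<times> 'i \<Rightarrow> int) \<times> (int \<times> 'i \<Rightarrow> int)) set"
where
  "sigma_tau_rel I \<U> \<G> =
     {(F, H) \<in> ah_fun_limit I \<G> \<times> ah_fun_limit I \<G>.
        eventually (\<lambda>i. i \<in> {i \<in> I. (slice F i, slice H i) \<in> sigma_rel}) \<U>}"

definition limit_quot ::
  "'i set \<Rightarrow> 'i filter \<Rightarrow> ('i \<times> 'i) filter \<Rightarrow> (int \<times> 'i \<Rightarrow> int) set set" where
  "limit_quot I \<U> \<G> = ah_fun_limit I \<G> // sigma_tau_rel I \<U> \<G>"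

definition fun_add ::
  "'i set \<Rightarrow> (int \<times> 'i \<Rightarrow> int) \<Rightarrow> (int \<times> 'i \<Rightarrow> int) \<Rightarrow> (int \<times> 'i \<Rightarrow> int)" where
  "fun_add I F H = (\<lambda>(m, i) \<in> UNIV \<times> I. F (m, i) + H (m, i))"

definition fun_comp ::
  "'i set \<Rightarrow> (int \<times> 'i \<Rightarrow> int) \<Rightarrow> (int \<times> 'i \<Rightarrow> int) \<Rightarrow> (int \<times> 'i \<Rightarrow> int)" where
  "fun_comp I F H = (\<lambda>(m, i) \<in> UNIV \<times> I. F (H (m, i), i))"

text \<open>The operations and the order induced on the quotient do not depend on the choice of
  representatives, so the unions below are unions of equal classes.\<close>

definition quot_add ::
  "'i set \<Rightarrow> 'i filter \<Rightarrow> ('i \<times> 'i) filter \<Rightarrow>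
   (int \<times> 'i \<Rightarrow> int) set \<Rightarrow> (int \<times> 'i \<Rightarrow> int) set \<Rightarrow> (int \<times> 'i \<Rightarrow> int) set" where
  "quot_add I \<U> \<G> X Y = (\<Union>F\<in>X. \<Union>H\<in>Y. sigma_tau_rel I \<U> \<G> `` {fun_add I F H})"

definition quot_mult ::
  "'i set \<Rightarrow> 'i filter \<Rightarrow> ('i \<times> 'i) filter \<Rightarrow>
   (int \<times> 'i \<Rightarrow> int) set \<Rightarrow> (int \<times> 'i \<Rightarrow> int) set \<Rightarrow> (int \<times> 'i \<Rightarrow> int) set" where
  "quot_mult I \<U> \<G> X Y = (\<Union>F\<in>X. \<Union>H\<in>Y. sigma_tau_rel I \<U> \<G> `` {fun_comp I F H})"

definition quot_less ::
  "'i set \<Rightarrow> 'i filter \<Rightarrow> (int \<times> 'i \<Rightarrow> int) set \<Rightarrow> (int \<times> 'i \<Rightarrow> int) set \<Rightarrow> bool" where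
  "quot_less I \<U> X Y \<longleftrightarrow>
     (\<exists>F\<in>X. \<exists>H\<in>Y. eventually
        (\<lambda>i. i \<in> {i \<in> I. sigma_less (sigma_class (slice F i)) (sigma_class (slice H i))}) \<U>)"

text \<open>A bijection that respects addition and multiplication also respects \<open>0\<close> and \<open>1\<close>.\<close>

definition ordered_field_iso ::
  "('k::linordered_field \<Rightarrow> 'q) \<Rightarrow> 'q set \<Rightarrow> ('q \<Rightarrow> 'q \<Rightarrow> 'q) \<Rightarrow> ('q \<Rightarrow> 'q \<Rightarrow> 'q) \<Rightarrow>
   ('q \<Rightarrow> 'q \<Rightarrow> bool) \<Rightarrow> bool"
where
  "ordered_field_iso h Q add mult lt \<longleftrightarrow>
     bij_betw h UNIV Q \<and>
     (\<forall>x y. h (x + y) = add (h x) (h y)) \<and>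
     (\<forall>x y. h (x * y) = mult (h x) (h y)) \<and>
     (\<forall>x y. x < y \<longleftrightarrow> lt (h x) (h y))"

end

theory Submission
  imports Defs
begin

text \<open>The hyperreal field \<open>'k\<close> is written as a limit ultrapower of the reals, in the manner of
  Keisler, and each real coordinate is then replaced by an almost homomorphism with that slope.

  The index set \<open>I\<close> consists of all maps \<open>i :: 'k \<Rightarrow> real\<close>. An element \<open>a\<close> of \<open>'k\<close> is to be
  represented by its coordinate \<open>i \<mapsto> i a\<close>. For this to be a homomorphism modulo an ultrafilter
  \<open>\<U>\<close>, every relation \<open>R\<close> that holds in \<open>'k\<close> of a tuple \<open>as\<close> must hold of \<open>map i as\<close> for
  \<open>\<U>\<close>-almost all \<open>i\<close>. The sets \<open>{i. map i as \<in> R}\<close> so prescribed are closed under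
  intersection up to refinement (\<open>true_tuples_conj\<close>), and they are nonempty
  (\<open>true_tuples_realized\<close>), because a formula that is satisfiable in \<open>'k\<close> is satisfiable in the
  reals. Hence some ultrafilter \<open>\<U>\<close> contains them all. It is nonprincipal because an element
  \<open>c\<close> outside the image of the reals differs from every real \<open>r\<close>, so that \<open>i c \<noteq> r\<close> for
  almost all \<open>i\<close>.

  The filter \<open>\<G>\<close> is generated by the sets of pairs that agree on a given finite subset of
  \<open>'k\<close>. It admits exactly the functions whose slope depends on finitely many coordinates, say
  as \<open>g (map i as)\<close>. The graph of \<open>g\<close> is one of the relations of the language, so that \<open>'k\<close>
  contains the value \<open>b\<close> of \<open>g\<close> at \<open>as\<close>, and then \<open>i b = g (map i as)\<close> for almost all
  \<open>i\<close> (\<open>finitary_function_value\<close>). So every class is the class of a coordinate.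

  On the integer side, an almost homomorphism stays within bounded distance of a unique linear
  map \<open>n \<mapsto> r n\<close> (\<open>almost_hom_has_slope\<close>). Its slope \<open>r\<close> determines its class, and turns
  pointwise sums into sums, composition into products, and the order of classes into the order
  of the reals.\<close>

section \<open>Eudoxus reals as slopes\<close>

definition has_slope :: "(int \<Rightarrow> int) \<Rightarrow> real \<Rightarrow> bool" where
  "has_slope f r \<longleftrightarrow> (\<exists>C. \<forall>n. \<bar>of_int (f n) - r * of_int n\<bar> \<le> C)"

definition slope :: "(int \<Rightarrow> int) \<Rightarrow> real" where
  "slope f = (THE r. has_slope f r)"

lemma unbounded_multiples:
  fixes r C :: real
  assumes "r > 0"
  obtains m :: nat where "r * real m > C"
  using reals_Archimedean3[OF assms] by (metis mult.commute)

text \<open>With \<open>C = 0\<close> this gives the uniqueness of slopes, in general their invariance under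
  bounded perturbation.\<close>

lemma has_slope_close_unique:
  assumes f: "has_slope f r" and g: "has_slope g s" and c: "\<And>n. \<bar>f n - g n\<bar> \<le> C"
  shows "r = s"
proof (rule ccontr)
  assume "r \<noteq> s"
  then have pos: "\<bar>r - s\<bar> > 0" by simp
  obtain A where A: "\<And>n. \<bar>of_int (f n) - r * of_int n\<bar> \<le> A" using f has_slope_def by auto
  obtain B where B: "\<And>n. \<bar>of_int (g n) - s * of_int n\<bar> \<le> B" using g has_slope_def by auto
  obtain m :: nat where m: "\<bar>r - s\<bar> * real m > A + B + of_int C"
    using unbounded_multiples[OF pos] by blast
  have "\<bar>real_of_int (f (int m)) - of_int (g (int m))\<bar> \<le> of_int C"
    using c[of "int m"] by linarith
  then have "\<bar>r * real m - s * real m\<bar> \<le> A + B + of_int C"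
    using A[of "int m"] B[of "int m"] by simp
  moreover have "\<bar>r * real m - s * real m\<bar> = \<bar>r - s\<bar> * real m"
    by (simp add: abs_mult flip: left_diff_distrib)
  ultimately show False using m by linarith
qed

lemma slope_eqI:
  assumes "has_slope f r"
  shows "slope f = r"
  unfolding slope_def
proof (rule the_equality[of "has_slope f", OF assms])
  show "s = r" if "has_slope f s" for s
    by (rule has_slope_close_unique[OF that assms, of 0]) simp
qed

lemma has_slope_imp_almost_hom:
  assumes "has_slope f r"
  shows "almost_hom f"
proof -
  obtain A where A: "\<And>n. \<bar>of_int (f n) - r * of_int n\<bar> \<le> A"
    using assms has_slope_def by auto
  have "\<bar>f (p + q) - f p - f q\<bar> \<le> \<lceil>3 * A\<rceil>" for p q
  proof -
    have "r * of_int (p + q) = r * of_int p + r * of_int q" by (simp add: algebra_simps)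
    then have "\<bar>real_of_int (f (p + q)) - of_int (f p) - of_int (f q)\<bar> \<le> 3 * A"
      using A[of "p + q"] A[of p] A[of q] by linarith
    then show ?thesis by linarith
  qed
  then show ?thesis unfolding almost_hom_def by blast
qed

lemma almost_hom_multiple:
  assumes C: "\<And>p q. \<bar>f (p + q) - f p - f q\<bar> \<le> (C::int)"
  shows "\<bar>f (int m * n) - int m * f n\<bar> \<le> (int m + 1) * C"
proof (induction m)
  case 0
  then show ?case using C[of 0 0] by simp
next
  case (Suc m)
  have "f (int (Suc m) * n) - int (Suc m) * f n
        = (f (int m * n + n) - f (int m * n) - f n) + (f (int m * n) - int m * f n)"
    by (simp add: algebra_simps)
  then have "\<bar>f (int (Suc m) * n) - int (Suc m) * f n\<bar> \<le> C + (int m + 1) * C"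
    using C[of "int m * n" n] Suc by linarith
  then show ?case by (simp add: algebra_simps)
qed

text \<open>Let \<open>C\<close> bound the defect of additivity. Comparing \<open>f (m n)\<close> with \<open>m f n\<close> and with \<open>n f m\<close> shows that every lower estimate
  \<open>(f m - 2 C) / m\<close> is at most every upper estimate \<open>(f n + 2 C) / n\<close>. The supremum of the lower
  estimates therefore lies between them all, and is the slope.\<close>

lemma almost_hom_has_slope:
  assumes "almost_hom f"
  shows "has_slope f (slope f)"
proof -
  obtain C where C: "\<And>p q. \<bar>f (p + q) - f p - f q\<bar> \<le> C"
    using assms almost_hom_def by auto
  have C0: "C \<ge> 0" using C[of 0 0] by linarith
  define lo where "lo m = (real_of_int (f (int m)) - 2 * of_int C) / real m" for m
  define hi where "hi m = (real_of_int (f (int m)) + 2 * of_int C) / real m" for m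
  have lohi: "lo m \<le> hi n" if "m > 0" "n > 0" for m n
  proof -
    have "int n * f (int m) - int m * f (int n) \<le> (int m + 1) * C + (int n + 1) * C"
      using almost_hom_multiple[of f C m "int n", OF C]
        almost_hom_multiple[of f C n "int m", OF C]
      by (simp add: mult.commute)
    also have "\<dots> \<le> 2 * int m * C + 2 * int n * C"
    proof -
      have "(int m + 1) * C \<le> (2 * int m) * C" "(int n + 1) * C \<le> (2 * int n) * C"
        using that C0 by (intro mult_right_mono; simp)+
      then show ?thesis by linarith
    qed
    finally have "int n * f (int m) - int m * f (int n) \<le> 2 * int m * C + 2 * int n * C" .
    then have "real_of_int (int n * f (int m) - int m * f (int n))
                 \<le> real_of_int (2 * int m * C + 2 * int n * C)"
      by (simp only: of_int_le_iff)
    then have "real n * (of_int (f (int m)) - 2 * of_int C)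
                 \<le> real m * (of_int (f (int n)) + 2 * of_int C)"
      by (simp add: algebra_simps)
    then show ?thesis using that by (simp add: lo_def hi_def field_simps)
  qed
  define r where "r = (SUP m\<in>{0<..}. lo m)"
  have "bdd_above (lo ` {0<..})" by (rule bdd_aboveI[of _ "hi 1"]) (auto intro: lohi)
  then have lo: "lo m \<le> r" if "m > 0" for m
    unfolding r_def using that by (intro cSUP_upper) auto
  have hi: "r \<le> hi m" if "m > 0" for m
    unfolding r_def using lohi that by (intro cSUP_least) auto
  have nonneg: "\<bar>of_int (f (int m)) - r * real m\<bar> \<le> 2 * of_int C" for m
  proof (cases "m = 0")
    case True
    then show ?thesis using C[of 0 0] by simp
  next
    case False
    then show ?thesis using lo[of m] hi[of m] by (simp add: lo_def hi_def field_simps)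
  qed
  have "\<bar>of_int (f n) - r * of_int n\<bar> \<le> 4 * of_int C" for n
  proof (cases "n \<ge> 0")
    case True
    then show ?thesis using nonneg[of "nat n"] C0 by simp
  next
    case False
    have "\<bar>f 0 - f n - f (- n)\<bar> \<le> C" using C[of n "- n"] by simp
    moreover have "\<bar>f 0\<bar> \<le> C" using C[of 0 0] by simp
    ultimately have "\<bar>f n + f (- n)\<bar> \<le> 2 * C" by linarith
    then have "\<bar>real_of_int (f n) + of_int (f (- n))\<bar> \<le> 2 * of_int C"
      by linarith
    then show ?thesis using nonneg[of "nat (- n)"] False by simp
  qed
  then have "has_slope f r" unfolding has_slope_def by blast
  then show ?thesis using slope_eqI by metis
qed

lemma sigma_rel_iff:
  "(f, g) \<in> sigma_rel \<longleftrightarrow> almost_hom f \<and> almost_hom g \<and> slope f = slope g"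
proof -
  have "\<exists>C. \<forall>p. \<bar>f p - g p\<bar> \<le> C"
    if f: "almost_hom f" and g: "almost_hom g" and eq: "slope f = slope g"
  proof -
    obtain A where A: "\<And>n. \<bar>of_int (f n) - slope f * of_int n\<bar> \<le> A"
      using almost_hom_has_slope[OF f] has_slope_def by auto
    obtain B where B: "\<And>n. \<bar>of_int (g n) - slope f * of_int n\<bar> \<le> B"
      using almost_hom_has_slope[OF g] has_slope_def eq by auto
    have "\<bar>f n - g n\<bar> \<le> \<lceil>A + B\<rceil>" for n using A[of n] B[of n] by linarith
    then show ?thesis by blast
  qed
  then show ?thesis
    unfolding sigma_rel_def
    using has_slope_close_unique[OF almost_hom_has_slope almost_hom_has_slope, of f g] by blast
qed

lemma sigma_class_eq_iff:
  assumes "almost_hom f" "almost_hom g"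
  shows "sigma_class f = sigma_class g \<longleftrightarrow> slope f = slope g"
  using assms by (auto simp: sigma_class_def sigma_rel_iff set_eq_iff)

lemma unbounded_diff_iff_slope_less:
  assumes "almost_hom f" "almost_hom g"
  shows "\<not> bdd_above (range (\<lambda>m::nat. g (int m) - f (int m))) \<longleftrightarrow> slope f < slope g"
proof -
  obtain A where A: "\<And>n. \<bar>of_int (f n) - slope f * of_int n\<bar> \<le> A"
    using almost_hom_has_slope[OF assms(1)] has_slope_def by auto
  obtain B where B: "\<And>n. \<bar>of_int (g n) - slope g * of_int n\<bar> \<le> B"
    using almost_hom_has_slope[OF assms(2)] has_slope_def by auto
  have False if less: "slope f < slope g"
    and bdd: "bdd_above (range (\<lambda>m::nat. g (int m) - f (int m)))"
  proof -
    obtain D where D: "\<And>m::nat. g (int m) - f (int m) \<le> D"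
      using bdd by (auto simp: bdd_above_def)
    obtain m :: nat where m: "(slope g - slope f) * real m > A + B + of_int D"
      using unbounded_multiples[of "slope g - slope f"] less by auto
    have "real_of_int (g (int m)) - of_int (f (int m)) \<le> of_int D"
      using D[of m] by linarith
    moreover have "(slope g - slope f) * real m = slope g * real m - slope f * real m"
      by (rule left_diff_distrib)
    ultimately show False using A[of "int m"] B[of "int m"] m by simp
  qed
  moreover have "bdd_above (range (\<lambda>m::nat. g (int m) - f (int m)))" if "slope g \<le> slope f"
  proof -
    have "g (int m) - f (int m) \<le> \<lceil>A + B\<rceil>" for m :: nat
    proof -
      have "slope g * real m \<le> slope f * real m" using that by (simp add: mult_right_mono)
      then show ?thesis using A[of "int m"] B[of "int m"] by simp linarith
    qed
    then show ?thesis by (auto simp: bdd_above_def)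
  qed
  ultimately show ?thesis by force
qed

lemma sigma_less_iff:
  assumes "almost_hom f" "almost_hom g"
  shows "sigma_less (sigma_class f) (sigma_class g) \<longleftrightarrow> slope f < slope g"
  unfolding sigma_less_def sigma_class_def
  using assms unbounded_diff_iff_slope_less by (auto simp: sigma_rel_iff)

lemma has_slope_floor: "has_slope (\<lambda>n. \<lfloor>r * of_int n\<rfloor>) r"
proof -
  have "\<bar>of_int \<lfloor>r * of_int n\<rfloor> - r * of_int n\<bar> \<le> 1" for n :: int by linarith
  then show ?thesis unfolding has_slope_def by blast
qed

lemma has_slope_add:
  assumes "has_slope f r" "has_slope g s"
  shows "has_slope (\<lambda>n. f n + g n) (r + s)"
proof -
  obtain A where A: "\<And>n. \<bar>of_int (f n) - r * of_int n\<bar> \<le> A"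
    using assms(1) has_slope_def by auto
  obtain B where B: "\<And>n. \<bar>of_int (g n) - s * of_int n\<bar> \<le> B"
    using assms(2) has_slope_def by auto
  have "\<bar>of_int (f n + g n) - (r + s) * of_int n\<bar> \<le> A + B" for n
    using A[of n] B[of n] by (simp add: distrib_right)
  then show ?thesis unfolding has_slope_def by blast
qed

text \<open>The bounded error of \<open>g\<close> is only multiplied by \<open>\<bar>r\<bar>\<close> when \<open>f\<close> is applied.\<close>

lemma has_slope_compose:
  assumes "has_slope f r" "has_slope g s"
  shows "has_slope (\<lambda>n. f (g n)) (r * s)"
proof -
  obtain A where A: "\<And>n. \<bar>of_int (f n) - r * of_int n\<bar> \<le> A"
    using assms(1) has_slope_def by auto
  obtain B where B: "\<And>n. \<bar>of_int (g n) - s * of_int n\<bar> \<le> B"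
    using assms(2) has_slope_def by auto
  have "\<bar>of_int (f (g n)) - (r * s) * of_int n\<bar> \<le> A + \<bar>r\<bar> * B" for n
  proof -
    have "\<bar>r * of_int (g n) - r * (s * of_int n)\<bar> \<le> \<bar>r\<bar> * B"
      using B[of n] by (simp add: abs_mult mult_left_mono flip: right_diff_distrib)
    then show ?thesis using A[of "g n"] by (simp add: mult.assoc)
  qed
  then show ?thesis unfolding has_slope_def by blast
qed


section \<open>Ultrafilters\<close>

text \<open>By Zorn's lemma there is a minimal proper filter below \<open>F\<close>. Minimality forces it to
  contain every set that it meets.\<close>

lemma ultrafilter_below_exists:
  fixes F :: "'a filter"
  assumes "F \<noteq> bot"
  obtains U where "U \<le> F" "ultrafilter_on UNIV U"
proof -
  let ?A = "{G. G \<noteq> bot \<and> G \<le> F}"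
  have "\<exists>U\<in>?A. \<forall>G\<in>?A. G \<le> U \<longrightarrow> G = U"
  proof (rule predicate_Zorn)
    show "partial_order_on ?A (relation_of (\<lambda>G H. H \<le> G) ?A)"
      by (rule partial_order_on_relation_ofI) auto
    fix C assume C: "C \<in> Chains (relation_of (\<lambda>G H. H \<le> G) ?A)"
    then have sub: "C \<subseteq> ?A" and cmp: "\<And>G H. G \<in> C \<Longrightarrow> H \<in> C \<Longrightarrow> H \<le> G \<or> G \<le> H"
      by (auto simp: Chains_def relation_of_def)
    show "\<exists>U\<in>?A. \<forall>G\<in>C. U \<le> G"
    proof (cases "C = {}")
      case True
      then show ?thesis using assms by auto
    next
      case False
      then have "Inf C \<le> F" using sub by (auto intro: Inf_lower2)
      moreover have "eventually (\<lambda>_. False) (Inf C) \<longleftrightarrow> (\<exists>G\<in>C. eventually (\<lambda>_. False) G)"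
        using False cmp by (intro eventually_Inf_base) (auto intro: inf_greatest)
      then have "Inf C \<noteq> bot" using sub by (auto simp: trivial_limit_def)
      ultimately show ?thesis by (auto intro!: bexI[of _ "Inf C"] Inf_lower)
    qed
  qed
  then obtain U where U: "U \<noteq> bot" "U \<le> F"
    and max: "\<And>G. G \<noteq> bot \<Longrightarrow> G \<le> U \<Longrightarrow> G = U"
    by (auto dest: order_trans)
  have "eventually (\<lambda>x. x \<in> B) U \<or> eventually (\<lambda>x. x \<in> UNIV - B) U" for B
  proof (cases "inf U (principal B) = bot")
    case True
    then show ?thesis by (simp add: trivial_limit_def eventually_inf_principal)
  next
    case False
    then have "inf U (principal B) = U" by (intro max) auto
    then have "U \<le> principal B" by (simp add: le_iff_inf)
    then show ?thesis by (simp add: le_principal)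
  qed
  then show thesis
    using U that unfolding ultrafilter_on_def filter_on_def by auto
qed


section \<open>Relations that hold in a complete elementary extension\<close>

locale complete_extension =
  fixes e :: "real \<Rightarrow> 'k::linordered_field"
    and P :: "nat \<Rightarrow> real list set \<Rightarrow> 'k list set"
  assumes elementary: "wf_fm \<phi> \<Longrightarrow> sat (\<lambda>m R. R) v \<phi> \<longleftrightarrow> sat P (e \<circ> v) \<phi>"
begin

abbreviation sat_real :: "(nat \<Rightarrow> real) \<Rightarrow> fm \<Rightarrow> bool" where
  "sat_real \<equiv> sat (\<lambda>m R. R)"

text \<open>All later transfer goes through this lemma, often by refuting a negated formula. The
  elements of the extension that are values of the variables in \<open>X\<close> are removed one at a time,
  by existential quantification, until only images of reals are left and elementarity
  applies.\<close>

lemma sat_extension_imp_sat_real: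
  assumes "finite X" "\<And>x. x \<notin> X \<Longrightarrow> w x \<in> range e" "wf_fm \<phi>" "sat P w \<phi>"
  shows "\<exists>v. sat_real v \<phi>"
  using assms
proof (induction X arbitrary: w \<phi> rule: finite_induct)
  case empty
  then have "\<forall>x. \<exists>r. w x = e r" by blast
  then obtain v where "\<forall>x. w x = e (v x)" by metis
  then have "w = e \<circ> v" by auto
  then have "sat_real v \<phi>" using empty.prems elementary[of \<phi> v] by (simp only:)
  then show ?case by blast
next
  case (insert y X)
  have "sat P (w(y := e 0)) (Ex y \<phi>)"
    using insert.prems by (auto intro: exI[of _ "w y"])
  moreover have "(w(y := e 0)) x \<in> range e" if "x \<notin> X" for x
    using insert.prems(1)[of x] that by auto
  moreover have "wf_fm (Ex y \<phi>)" using insert.prems by simp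
  ultimately obtain v where "sat_real v (Ex y \<phi>)" using insert.IH by blast
  then show ?case by auto
qed

text \<open>The default value lies in the image of the reals, so that only the finitely many
  variables below \<open>length as\<close> need to be quantified away.\<close>

definition tuple_val :: "'k list \<Rightarrow> nat \<Rightarrow> 'k" where
  "tuple_val as x = (if x < length as then as ! x else e 0)"

lemma map_tuple_val: "map (tuple_val as) [0..<length as] = as"
  by (rule nth_equalityI) (auto simp: tuple_val_def)

lemma map_trm_val_Var: "map (trm_val v) (map Var xs) = map v xs"
  by simp

lemma sat_tuple_val_imp_sat_real:
  assumes "wf_fm \<phi>" "sat P (tuple_val as) \<phi>"
  shows "\<exists>v. sat_real v \<phi>"
  by (rule sat_extension_imp_sat_real[of "{..<length as}"]) (use assms in \<open>auto simp: tuple_val_def\<close>)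

definition true_tuples :: "('k list \<times> real list set) set" where
  "true_tuples = {(as, R). as \<noteq> [] \<and> R \<subseteq> {xs. length xs = length as} \<and> as \<in> P (length as) R}"

text \<open>Only the variables below \<open>m\<close> are recorded. Other free variables of \<open>\<phi>\<close> are in effect
  existentially quantified.\<close>

definition solutions :: "nat \<Rightarrow> fm \<Rightarrow> real list set" where
  "solutions m \<phi> = {map v [0..<m] | v. sat_real v \<phi>}"

text \<open>Otherwise \<open>\<phi>\<close> together with the negation of its own solution relation would be
  satisfiable, in the extension and hence in the reals.\<close>

lemma solutions_true:
  assumes "as \<noteq> []" "wf_fm \<phi>" "sat P (tuple_val as) \<phi>"
  shows "(as, solutions (length as) \<phi>) \<in> true_tuples"
proof (rule ccontr)
  let ?m = "length as"
  let ?\<psi> = "Conj \<phi> (Neg (Rel ?m (solutions ?m \<phi>) (map Var [0..<?m])))"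
  assume "(as, solutions ?m \<phi>) \<notin> true_tuples"
  then have "as \<notin> P ?m (solutions ?m \<phi>)"
    using assms by (auto simp: true_tuples_def solutions_def)
  then have "sat P (tuple_val as) ?\<psi>"
    using assms by (simp add: map_tuple_val map_trm_val_Var del: map_map)
  moreover have "wf_fm ?\<psi>" using assms by (auto simp: solutions_def Suc_le_eq)
  ultimately obtain v where "sat_real v ?\<psi>" using sat_tuple_val_imp_sat_real by blast
  then show False by (auto simp: solutions_def map_trm_val_Var simp del: map_map)
qed

text \<open>The entries of \<open>as\<close> may repeat. Each element of \<open>'k\<close> is therefore given one variable
  by an injection \<open>pos\<close>, and a real solution \<open>v\<close> yields a map that is well defined on \<open>'k\<close>.\<close>

lemma true_tuples_realized:
  assumes "(as, R) \<in> true_tuples"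
  obtains i :: "'k \<Rightarrow> real" where "map i as \<in> R"
proof -
  obtain pos :: "'k \<Rightarrow> nat" where inj: "inj_on pos (set as)"
    using finite_imp_inj_to_nat_seg[of "set as"] by auto
  define w where "w x = (if x \<in> pos ` set as then the_inv_into (set as) pos x else e 0)" for x
  let ?\<phi> = "Rel (length as) R (map Var (map pos as))"
  have "map (w \<circ> pos) as = as"
    by (rule map_idI) (auto simp: w_def the_inv_into_f_f[OF inj])
  then have "sat P w ?\<phi>" "wf_fm ?\<phi>"
    using assms by (auto simp: true_tuples_def map_trm_val_Var Suc_le_eq comp_def)
  then obtain v where "sat_real v ?\<phi>"
    using sat_extension_imp_sat_real[of "pos ` set as" w ?\<phi>] by (auto simp: w_def)
  then show thesis using that[of "v \<circ> pos"] by (simp add: comp_def)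
qed

text \<open>Modulo this filter, the coordinates \<open>i \<mapsto> i a\<close> satisfy every relation that is true of the
  elements \<open>a\<close> in the extension: it encodes the complete type of all elements of \<open>'k\<close>.\<close>

definition type_filter :: "('k \<Rightarrow> real) filter" where
  "type_filter = (INF (as, R)\<in>true_tuples. principal {i. map i as \<in> R})"

text \<open>The concatenation \<open>as @ bs\<close> satisfies the relation that asserts \<open>R\<close> of the first
  \<open>length as\<close> entries and \<open>S\<close> of the others.\<close>

lemma true_tuples_conj:
  assumes "(as, R) \<in> true_tuples" "(bs, S) \<in> true_tuples"
  obtains cs T where "(cs, T) \<in> true_tuples"
    "\<And>i. map i cs \<in> T \<Longrightarrow> map i as \<in> R \<and> map i bs \<in> S"
proof -
  let ?m = "length as" and ?n = "length bs"
  let ?\<phi> = "Conj (Rel ?m R (map Var [0..<?m])) (Rel ?n S (map Var [?m..<?m + ?n]))"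
  have split: "map f [0..<?m + ?n] = map f [0..<?m] @ map f [?m..<?m + ?n]" for f :: "nat \<Rightarrow> 'b"
    by (subst upt_add_eq_append) simp_all
  have "map (tuple_val (as @ bs)) [0..<?m + ?n] = as @ bs"
    using map_tuple_val[of "as @ bs"] by simp
  then have "map (tuple_val (as @ bs)) [0..<?m] = as"
    "map (tuple_val (as @ bs)) [?m..<?m + ?n] = bs"
    by (simp_all add: split)
  then have "(as @ bs, solutions (length (as @ bs)) ?\<phi>) \<in> true_tuples"
    using assms
    by (intro solutions_true) (auto simp: true_tuples_def Suc_le_eq map_trm_val_Var simp del: map_map)
  moreover have "map i as \<in> R \<and> map i bs \<in> S"
    if "map i (as @ bs) \<in> solutions (length (as @ bs)) ?\<phi>" for i
    using that by (auto simp: solutions_def split map_trm_val_Var simp del: map_map)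
  ultimately show thesis using that by blast
qed

lemma eventually_type_filter:
  "eventually Q type_filter \<longleftrightarrow> (\<exists>(as, R)\<in>true_tuples. \<forall>i. map i as \<in> R \<longrightarrow> Q i)"
proof -
  have "([0], solutions (length [0::'k]) (Eq Zero Zero)) \<in> true_tuples"
    by (rule solutions_true) auto
  then have "true_tuples \<noteq> {}" by blast
  moreover have "\<exists>x\<in>true_tuples. (case x of (cs, T) \<Rightarrow> principal {i. map i cs \<in> T})
      \<le> inf (case a of (as, R) \<Rightarrow> principal {i. map i as \<in> R})
          (case b of (bs, S) \<Rightarrow> principal {i. map i bs \<in> S})"
    if ab: "a \<in> true_tuples" "b \<in> true_tuples" for a b
  proof -
    obtain as R bs S where [simp]: "a = (as, R)" "b = (bs, S)" by fastforce
    obtain cs T where "(cs, T) \<in> true_tuples"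
      "\<And>i. map i cs \<in> T \<Longrightarrow> map i as \<in> R \<and> map i bs \<in> S"
      using true_tuples_conj ab by auto metis
    then show ?thesis by (intro bexI[of _ "(cs, T)"]) auto
  qed
  ultimately have "eventually Q type_filter \<longleftrightarrow>
      (\<exists>x\<in>true_tuples. eventually Q (case x of (as, R) \<Rightarrow> principal {i. map i as \<in> R}))"
    unfolding type_filter_def by (rule eventually_INF_base)
  then show ?thesis by (simp add: eventually_principal split_beta)
qed

lemma type_filter_not_bot: "type_filter \<noteq> bot"
proof
  assume "type_filter = bot"
  then obtain as R where "(as, R) \<in> true_tuples" "\<And>i. map i as \<notin> R"
    using eventually_type_filter[of "\<lambda>_. False"] by (auto simp: trivial_limit_def)
  then show False using true_tuples_realized by blast
qed

text \<open>The half of the theorem of Los that is needed: what \<open>'k\<close> satisfies holds in almost all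
  coordinates. For a formula whose free variables are among the first \<open>length as\<close>, the
  valuation \<open>v\<close> may be read off from \<open>i\<close> directly.\<close>

lemma eventually_solution:
  assumes "as \<noteq> []" "wf_fm \<phi>" "sat P (tuple_val as) \<phi>"
  shows "eventually (\<lambda>i. \<exists>v. sat_real v \<phi> \<and> (\<forall>p<length as. v p = i (as ! p))) type_filter"
  unfolding eventually_type_filter
proof (intro bexI[OF _ solutions_true[OF assms]] case_prodI allI impI)
  fix i assume "map i as \<in> solutions (length as) \<phi>"
  then obtain v where v: "sat_real v \<phi>" "map i as = map v [0..<length as]"
    by (auto simp: solutions_def)
  have "v p = i (as ! p)" if "p < length as" for p
    using arg_cong[OF v(2), of "\<lambda>xs. xs ! p"] that by simp
  then show "\<exists>v. sat_real v \<phi> \<and> (\<forall>p<length as. v p = i (as ! p))" using v by blast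
qed

lemma eventually_add: "eventually (\<lambda>i. i (a + b) = i a + i b) type_filter"
  by (rule eventually_mono[OF eventually_solution
        [of "[a, b, a + b]" "Eq (Plus (Var 0) (Var 1)) (Var 2)"]])
    (auto simp: tuple_val_def All_less_Suc numeral_2_eq_2)

lemma eventually_mult: "eventually (\<lambda>i. i (a * b) = i a * i b) type_filter"
  by (rule eventually_mono[OF eventually_solution
        [of "[a, b, a * b]" "Eq (Times (Var 0) (Var 1)) (Var 2)"]])
    (auto simp: tuple_val_def All_less_Suc numeral_2_eq_2)

lemma eventually_less:
  assumes "a < b"
  shows "eventually (\<lambda>i. i a < i b) type_filter"
  by (rule eventually_mono[OF eventually_solution
        [of "[a, b]" "Neg (Le (Var 1) (Var 0))"]])
    (use assms in \<open>auto simp: tuple_val_def All_less_Suc not_le\<close>)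

text \<open>The symbol for the singleton \<open>{r}\<close> is true in the extension of \<open>e r\<close> alone, since
  in the reals any two elements that satisfy it are equal.\<close>

lemma eventually_not_standard:
  assumes "c \<notin> range e"
  shows "eventually (\<lambda>i. i c \<noteq> r) type_filter"
proof -
  let ?\<rho> = "\<lambda>x. Rel 1 {[r]} [Var x]"
  have std: "[e r] \<in> P 1 {[r]}"
    using elementary[of "?\<rho> 0" "\<lambda>_. r"] by simp
  have "[c] \<notin> P 1 {[r]}"
  proof
    assume "[c] \<in> P 1 {[r]}"
    moreover have "c \<noteq> e r" using assms by auto
    ultimately have "\<exists>v. sat_real v (Conj (Conj (?\<rho> 0) (?\<rho> 1)) (Neg (Eq (Var 0) (Var 1))))"
      by (intro sat_tuple_val_imp_sat_real[of _ "[c, e r]"]) (use std in \<open>auto simp: tuple_val_def\<close>)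
    then show False by auto
  qed
  then show ?thesis
    by (intro eventually_mono[OF eventually_solution[of "[c]" "Neg (?\<rho> 0)"]])
      (auto simp: tuple_val_def)
qed

text \<open>The sentence saying that \<open>g\<close> has a value at every tuple transfers to the extension, and
  \<open>b\<close> is the value there at \<open>as\<close>.\<close>

lemma finitary_function_value:
  fixes g :: "real list \<Rightarrow> real"
  obtains b where "eventually (\<lambda>i. i b = g (map i as)) type_filter"
proof -
  let ?m = "length as"
  define R where "R = {xs @ [g xs] | xs. length xs = ?m}"
  let ?\<rho> = "Rel (Suc ?m) R (map Var [0..<Suc ?m])"
  have upd: "map (v(?m := b)) [0..<Suc ?m] = map v [0..<?m] @ [b]" for v :: "nat \<Rightarrow> 'b" and b
    by simp
  have "sat P (tuple_val as) (Ex ?m ?\<rho>)"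
  proof (rule ccontr)
    assume "\<not> sat P (tuple_val as) (Ex ?m ?\<rho>)"
    then have "sat P (tuple_val as) (Neg (Ex ?m ?\<rho>))" by (simp only: sat.simps not_False_eq_True)
    moreover have "wf_fm (Neg (Ex ?m ?\<rho>))" by (auto simp: R_def)
    ultimately obtain v where v: "sat_real v (Neg (Ex ?m ?\<rho>))"
      using sat_tuple_val_imp_sat_real by blast
    have "map v [0..<?m] @ [g (map v [0..<?m])] \<in> R" by (simp add: R_def)
    then show False using v by (auto simp only: sat.simps map_trm_val_Var upd)
  qed
  then obtain b where "as @ [b] \<in> P (Suc ?m) R"
    by (auto simp only: sat.simps map_trm_val_Var upd map_tuple_val)
  then have "(as @ [b], R) \<in> true_tuples" by (auto simp: true_tuples_def R_def)
  then have "eventually (\<lambda>i. i b = g (map i as)) type_filter"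
    unfolding eventually_type_filter by (rule bexI[rotated]) (auto simp: R_def)
  then show thesis by (rule that)
qed

end


section \<open>Functions that depend on finitely many coordinates\<close>

definition agreement_filter :: "(('k \<Rightarrow> real) \<times> ('k \<Rightarrow> real)) filter" where
  "agreement_filter = (INF A\<in>{A. finite A}. principal {(i, j). \<forall>a\<in>A. i a = j a})"

text \<open>This says that \<open>agreement_filter\<close> contains the set of pairs \<open>(i, j)\<close> with
  \<open>f i = f j\<close>.\<close>

definition finitary :: "(('k \<Rightarrow> real) \<Rightarrow> real) \<Rightarrow> bool" where
  "finitary f \<longleftrightarrow> (\<exists>A. finite A \<and> (\<forall>i j. (\<forall>a\<in>A. i a = j a) \<longrightarrow> f i = f j))"

lemma eventually_agreement_filter:
  "eventually Q agreement_filter \<longleftrightarrow>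
     (\<exists>A. finite A \<and> (\<forall>i j. (\<forall>a\<in>A. i a = j a) \<longrightarrow> Q (i, j)))"
proof -
  have "\<exists>C\<in>{C. finite C}. principal {(i :: 'k \<Rightarrow> real, j). \<forall>a\<in>C. i a = j a}
      \<le> inf (principal {(i, j). \<forall>a\<in>A. i a = j a}) (principal {(i, j). \<forall>a\<in>B. i a = j a})"
    if "finite A" "finite B" for A B :: "'k set"
    by (rule bexI[of _ "A \<union> B"]) (use that in auto)
  then show ?thesis
    unfolding agreement_filter_def
    by (subst eventually_INF_base) (auto simp: eventually_principal)
qed

lemma filter_on_agreement_filter: "filter_on (UNIV \<times> UNIV) agreement_filter"
  by (auto simp: filter_on_def trivial_limit_def eventually_agreement_filter)

lemma finitary_coordinate: "finitary (\<lambda>i. i a)"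
  unfolding finitary_def by (rule exI[of _ "{a}"]) auto

lemma finitary_combine:
  assumes "finitary f" "finitary g"
  shows "finitary (\<lambda>i. h (f i) (g i))"
proof -
  obtain A B where "finite A" "\<forall>i j. (\<forall>a\<in>A. i a = j a) \<longrightarrow> f i = f j"
    "finite B" "\<forall>i j. (\<forall>a\<in>B. i a = j a) \<longrightarrow> g i = g j"
    using assms unfolding finitary_def by blast
  then have "finite (A \<union> B) \<and> (\<forall>i j. (\<forall>a\<in>A \<union> B. i a = j a) \<longrightarrow> h (f i) (g i) = h (f j) (g j))"
    by (metis Un_iff finite_UnI)
  then show ?thesis unfolding finitary_def by blast
qed

lemma finitary_factors_through_list:
  fixes f :: "('k \<Rightarrow> real) \<Rightarrow> real"
  assumes "finitary f"
  obtains as g where "\<And>i. f i = g (map i as)"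
proof -
  obtain A where A: "finite A" "\<And>i j. (\<forall>a\<in>A. i a = j a) \<Longrightarrow> f i = f j"
    using assms unfolding finitary_def by blast
  obtain as where as: "set as = A" using A(1) finite_list by blast
  \<comment> \<open>Any choice will do, as \<open>f\<close> has the same value at all \<open>j\<close> with the same restriction to
    \<open>A\<close>.\<close>
  define g where "g xs = f (SOME j. map j as = xs)" for xs
  have "f i = g (map i as)" for i
  proof -
    have "map (SOME j. map j as = map i as) as = map i as"
      by (rule someI[of "\<lambda>j. map j as = map i as" i]) simp
    then show ?thesis unfolding g_def by (intro A(2)) (simp add: as)
  qed
  then show thesis by (rule that)
qed


section \<open>The limit of integer-valued functions\<close>

abbreviation slopes :: "(int \<times> 'i \<Rightarrow> int) \<Rightarrow> 'i \<Rightarrow> real" where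
  "slopes F i \<equiv> slope (slice F i)"

abbreviation limit_funs :: "(int \<times> ('k \<Rightarrow> real) \<Rightarrow> int) set" where
  "limit_funs \<equiv> ah_fun_limit UNIV agreement_filter"

text \<open>Two almost homomorphisms have equal classes iff they have equal slopes, so the condition
  on \<open>eq_set\<close> concerns only the slope function.\<close>

lemma limit_funs_iff:
  "F \<in> limit_funs \<longleftrightarrow> (\<forall>i. almost_hom (slice F i)) \<and> finitary (slopes F)"
  by (auto simp: ah_fun_limit_def ah_fun_def eq_set_def finitary_def
      eventually_agreement_filter sigma_class_eq_iff)

lemma limit_funsI:
  assumes "\<And>i. has_slope (slice F i) (f i)" "finitary f"
  shows "F \<in> limit_funs" "slopes F i = f i"
proof -
  have "slopes F = f" using assms(1) slope_eqI by blast
  then show "F \<in> limit_funs" "slopes F i = f i"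
    using assms has_slope_imp_almost_hom unfolding limit_funs_iff by auto
qed

lemma limit_funs_has_slope:
  "F \<in> limit_funs \<Longrightarrow> has_slope (slice F i) (slopes F i)"
  using almost_hom_has_slope limit_funs_iff by blast

lemma sigma_tau_rel_iff:
  "(F, H) \<in> sigma_tau_rel UNIV U agreement_filter \<longleftrightarrow>
     F \<in> limit_funs \<and> H \<in> limit_funs \<and> eventually (\<lambda>i. slopes F i = slopes H i) U"
  by (auto simp: sigma_tau_rel_def sigma_rel_iff limit_funs_iff)

lemma fun_add_limit:
  assumes "F \<in> limit_funs" "H \<in> limit_funs"
  shows "fun_add UNIV F H \<in> limit_funs"
    and "slopes (fun_add UNIV F H) i = slopes F i + slopes H i"
proof -
  have "has_slope (slice (fun_add UNIV F H) i) (slopes F i + slopes H i)" for i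
    using assms by (simp add: fun_add_def has_slope_add limit_funs_has_slope)
  moreover have "finitary (\<lambda>i. slopes F i + slopes H i)"
    using assms by (intro finitary_combine[of "slopes F" "slopes H" "(+)"]) (simp_all add: limit_funs_iff)
  ultimately show "fun_add UNIV F H \<in> limit_funs"
    "slopes (fun_add UNIV F H) i = slopes F i + slopes H i"
    by (rule limit_funsI)+
qed

lemma fun_comp_limit:
  assumes "F \<in> limit_funs" "H \<in> limit_funs"
  shows "fun_comp UNIV F H \<in> limit_funs"
    and "slopes (fun_comp UNIV F H) i = slopes F i * slopes H i"
proof -
  have "has_slope (slice (fun_comp UNIV F H) i) (slopes F i * slopes H i)" for i
    using has_slope_compose[OF limit_funs_has_slope limit_funs_has_slope, OF assms]
    by (simp add: fun_comp_def)
  moreover have "finitary (\<lambda>i. slopes F i * slopes H i)"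
    using assms by (intro finitary_combine[of "slopes F" "slopes H" "(*)"]) (simp_all add: limit_funs_iff)
  ultimately show "fun_comp UNIV F H \<in> limit_funs"
    "slopes (fun_comp UNIV F H) i = slopes F i * slopes H i"
    by (rule limit_funsI)+
qed

definition coordinate_fun :: "'k \<Rightarrow> int \<times> ('k \<Rightarrow> real) \<Rightarrow> int" where
  "coordinate_fun a = (\<lambda>(n, i). \<lfloor>i a * of_int n\<rfloor>)"

lemma coordinate_fun_limit:
  "coordinate_fun a \<in> limit_funs" "slopes (coordinate_fun a) i = i a"
proof -
  have "has_slope (slice (coordinate_fun a) i) (i a)" for i
    using has_slope_floor by (simp add: coordinate_fun_def)
  then show "coordinate_fun a \<in> limit_funs" "slopes (coordinate_fun a) i = i a"
    by (rule limit_funsI[OF _ finitary_coordinate])+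
qed

definition coordinate_class ::
  "('k \<Rightarrow> real) filter \<Rightarrow> 'k \<Rightarrow> (int \<times> ('k \<Rightarrow> real) \<Rightarrow> int) set" where
  "coordinate_class U a = sigma_tau_rel UNIV U agreement_filter `` {coordinate_fun a}"

lemma mem_coordinate_class_iff:
  "F \<in> coordinate_class U a \<longleftrightarrow> F \<in> limit_funs \<and> eventually (\<lambda>i. slopes F i = i a) U"
  by (auto simp: coordinate_class_def sigma_tau_rel_iff coordinate_fun_limit eq_commute)

lemma coordinate_fun_mem_class: "coordinate_fun a \<in> coordinate_class U a"
  by (simp add: mem_coordinate_class_iff coordinate_fun_limit)

lemma class_eq_coordinate_class:
  assumes "F \<in> coordinate_class U a"
  shows "sigma_tau_rel UNIV U agreement_filter `` {F} = coordinate_class U a"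
proof -
  have ev: "eventually (\<lambda>i. slopes F i = i a) U" and F: "F \<in> limit_funs"
    using assms by (simp_all add: mem_coordinate_class_iff)
  have "eventually (\<lambda>i. slopes F i = slopes H i) U \<longleftrightarrow> eventually (\<lambda>i. slopes H i = i a) U" for H
  proof (rule eventually_subst)
    show "eventually (\<lambda>i. slopes F i = slopes H i \<longleftrightarrow> slopes H i = i a) U"
      using ev by eventually_elim auto
  qed
  then show ?thesis
    using F by (auto simp: mem_coordinate_class_iff sigma_tau_rel_iff)
qed


section \<open>The isomorphism\<close>

text \<open>Any proper filter \<open>U\<close> that refines \<open>type_filter\<close> serves, because the classes in
  question are classes of coordinates, on which \<open>type_filter\<close> already decides sums, products
  and the order.\<close>

theorem (in complete_extension) coordinate_class_iso:
  assumes le: "U \<le> type_filter" and proper: "U \<noteq> bot"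
  shows "ordered_field_iso (coordinate_class U) (limit_quot UNIV U agreement_filter)
           (quot_add UNIV U agreement_filter) (quot_mult UNIV U agreement_filter)
           (quot_less UNIV U)"
  unfolding ordered_field_iso_def
proof (intro conjI allI)
  note ev = filter_leD[OF le]
  have less_iff: "a < b \<longleftrightarrow> eventually (\<lambda>i. i a < i b) U" for a b
  proof
    assume lt: "eventually (\<lambda>i. i a < i b) U"
    show "a < b"
    proof (rule ccontr)
      assume "\<not> a < b"
      then have "eventually (\<lambda>i. i b \<le> i a) U"
        using ev[OF eventually_less[of b a]]
        by (cases "a = b") (auto elim!: eventually_mono)
      with lt have "eventually (\<lambda>_. False) U" by eventually_elim simp
      then show False using proper by (simp add: trivial_limit_def)
    qed
  qed (rule ev[OF eventually_less])
  show "bij_betw (coordinate_class U) UNIV (limit_quot UNIV U agreement_filter)"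
    unfolding bij_betw_def
  proof
    show "inj (coordinate_class U)"
    proof
      fix a b assume "coordinate_class U a = coordinate_class U b"
      then have eq: "eventually (\<lambda>i. i a = i b) U"
        using coordinate_fun_mem_class[of a U] by (simp add: mem_coordinate_class_iff coordinate_fun_limit)
      show "a = b"
      proof (rule ccontr)
        assume "a \<noteq> b"
        then consider "a < b" | "b < a" by fastforce
        then have "eventually (\<lambda>i. i a \<noteq> i b) U"
        proof cases
          case 1
          then show ?thesis unfolding less_iff by (rule eventually_mono) simp
        next
          case 2
          then show ?thesis unfolding less_iff by (rule eventually_mono) simp
        qed
        with eq have "eventually (\<lambda>_. False) U" by eventually_elim simp
        then show False using proper by (simp add: trivial_limit_def)
      qed
    qed
    have "\<exists>b. F \<in> coordinate_class U b" if F: "F \<in> limit_funs" for F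
    proof -
      obtain as g where g: "\<And>i. slopes F i = g (map i as)"
        using F unfolding limit_funs_iff by (metis finitary_factors_through_list)
      obtain b where "eventually (\<lambda>i. i b = g (map i as)) type_filter"
        using finitary_function_value .
      from ev[OF this] have "eventually (\<lambda>i. slopes F i = i b) U"
        by eventually_elim (simp add: g)
      with F have "F \<in> coordinate_class U b" by (simp add: mem_coordinate_class_iff)
      then show ?thesis ..
    qed
    then have onto: "\<exists>b. sigma_tau_rel UNIV U agreement_filter `` {F} = coordinate_class U b"
      if "F \<in> limit_funs" for F
      using class_eq_coordinate_class that by metis
    have "coordinate_class U b \<in> limit_quot UNIV U agreement_filter" for b
      unfolding coordinate_class_def limit_quot_def
      by (rule quotientI[OF coordinate_fun_limit(1)])
    moreover have "X \<in> range (coordinate_class U)"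
      if "X \<in> limit_quot UNIV U agreement_filter" for X
      using that onto unfolding limit_quot_def by (metis quotientE rangeI)
    ultimately show "range (coordinate_class U) = limit_quot UNIV U agreement_filter" by auto
  qed
  fix a b
  have nonempty: "coordinate_class U c \<noteq> {}" for c
    using coordinate_fun_mem_class[of c U] by auto
  \<comment> \<open>Both operations on classes are unions over representatives, so it suffices that every
    pair of representatives is sent into the class of the result.\<close>
  have union: "(\<Union>F\<in>coordinate_class U a. \<Union>H\<in>coordinate_class U b.
      sigma_tau_rel UNIV U agreement_filter `` {op F H}) = coordinate_class U c"
    if "\<And>F H. F \<in> coordinate_class U a \<Longrightarrow> H \<in> coordinate_class U b \<Longrightarrow> op F H \<in> coordinate_class U c"
    for op c
    using nonempty by (simp add: class_eq_coordinate_class[OF that])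
  have "fun_add UNIV F H \<in> coordinate_class U (a + b)"
    if "F \<in> coordinate_class U a" "H \<in> coordinate_class U b" for F H
  proof -
    have FH: "F \<in> limit_funs" "H \<in> limit_funs"
      and slopes: "eventually (\<lambda>i. slopes F i = i a) U" "eventually (\<lambda>i. slopes H i = i b) U"
      using that by (simp_all add: mem_coordinate_class_iff)
    have "eventually (\<lambda>i. slopes (fun_add UNIV F H) i = i (a + b)) U"
      using slopes ev[OF eventually_add[of a b]] unfolding fun_add_limit(2)[OF FH] by eventually_elim simp
    then show ?thesis using fun_add_limit(1)[OF FH] by (simp add: mem_coordinate_class_iff)
  qed
  then show "coordinate_class U (a + b)
      = quot_add UNIV U agreement_filter (coordinate_class U a) (coordinate_class U b)"
    unfolding quot_add_def by (rule union[symmetric])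
  have "fun_comp UNIV F H \<in> coordinate_class U (a * b)"
    if "F \<in> coordinate_class U a" "H \<in> coordinate_class U b" for F H
  proof -
    have FH: "F \<in> limit_funs" "H \<in> limit_funs"
      and slopes: "eventually (\<lambda>i. slopes F i = i a) U" "eventually (\<lambda>i. slopes H i = i b) U"
      using that by (simp_all add: mem_coordinate_class_iff)
    have "eventually (\<lambda>i. slopes (fun_comp UNIV F H) i = i (a * b)) U"
      using slopes ev[OF eventually_mult[of a b]] unfolding fun_comp_limit(2)[OF FH] by eventually_elim simp
    then show ?thesis using fun_comp_limit(1)[OF FH] by (simp add: mem_coordinate_class_iff)
  qed
  then show "coordinate_class U (a * b)
      = quot_mult UNIV U agreement_filter (coordinate_class U a) (coordinate_class U b)"
    unfolding quot_mult_def by (rule union[symmetric])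
  have "eventually (\<lambda>i. i \<in> {i \<in> UNIV. sigma_less (sigma_class (slice F i)) (sigma_class (slice H i))}) U
      \<longleftrightarrow> a < b"
    if F: "F \<in> coordinate_class U a" and H: "H \<in> coordinate_class U b" for F H
  proof -
    have ah: "\<And>i. almost_hom (slice F i)" "\<And>i. almost_hom (slice H i)"
      and slopes: "eventually (\<lambda>i. slopes F i = i a) U" "eventually (\<lambda>i. slopes H i = i b) U"
      using F H by (simp_all add: mem_coordinate_class_iff limit_funs_iff)
    from slopes have "eventually (\<lambda>i. slopes F i < slopes H i \<longleftrightarrow> i a < i b) U"
      by eventually_elim simp
    then show ?thesis unfolding less_iff by (simp add: sigma_less_iff[OF ah] eventually_subst)
  qed
  then show "a < b \<longleftrightarrow> quot_less UNIV U (coordinate_class U a) (coordinate_class U b)"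
    unfolding quot_less_def using nonempty by (simp cong: bex_cong) blast
qed

theorem theorem6p2:
  assumes "hyperreal_field TYPE('k::linordered_field)"
  shows "\<exists>(I :: ('k \<Rightarrow> real) set) (\<U> :: ('k \<Rightarrow> real) filter)
            (\<G> :: (('k \<Rightarrow> real) \<times> ('k \<Rightarrow> real)) filter).
           infinite I \<and>
           ultrafilter_on I \<U> \<and> nonprincipal_on I \<U> \<and>
           filter_on (I \<times> I) \<G> \<and>
           (\<exists>h :: 'k \<Rightarrow> (int \<times> ('k \<Rightarrow> real) \<Rightarrow> int) set.
              ordered_field_iso h (limit_quot I \<U> \<G>)
                (quot_add I \<U> \<G>) (quot_mult I \<U> \<G>) (quot_less I \<U>))"
proof -
  obtain e :: "real \<Rightarrow> 'k" and P where "\<not> surj e"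
    and "\<forall>\<phi> v. wf_fm \<phi> \<longrightarrow> (sat (\<lambda>m R. R) v \<phi> \<longleftrightarrow> sat P (e \<circ> v) \<phi>)"
    using assms unfolding hyperreal_field_def by blast
  then interpret complete_extension e P by unfold_locales blast
  obtain c where c: "c \<notin> range e" using \<open>\<not> surj e\<close> by blast
  obtain U where U: "U \<le> type_filter" "ultrafilter_on UNIV U"
    using ultrafilter_below_exists[OF type_filter_not_bot] .
  then have "U \<noteq> bot" by (simp add: ultrafilter_on_def filter_on_def)
  have "\<not> eventually (\<lambda>i. i \<in> {j}) U" for j
  proof
    assume "eventually (\<lambda>i. i \<in> {j}) U"
    moreover have "eventually (\<lambda>i. i c \<noteq> j c) U"
      using filter_leD[OF U(1) eventually_not_standard[OF c]] .
    ultimately have "eventually (\<lambda>_. False) U" by eventually_elim simp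
    then show False using \<open>U \<noteq> bot\<close> by (simp add: trivial_limit_def)
  qed
  then have "nonprincipal_on UNIV U" by (simp add: nonprincipal_on_def)
  moreover have "infinite (UNIV :: ('k \<Rightarrow> real) set)"
  proof
    assume "finite (UNIV :: ('k \<Rightarrow> real) set)"
    then have "finite (range (\<lambda>r (_ :: 'k). r :: real))" by (rule finite_subset[rotated]) simp
    then have "finite (UNIV :: real set)"
      by (rule finite_imageD) (auto intro!: injI dest: fun_cong)
    then show False using infinite_UNIV_char_0 by blast
  qed
  ultimately show ?thesis
    using U filter_on_agreement_filter coordinate_class_iso[OF U(1) \<open>U \<noteq> bot\<close>] by blast
qed

end
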